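(* Let $\overline{n}=(n_1,\dots,n_t)\in\mathbb{N}_{>0}^t$ and $\overline{m}=(m_1,\dots,m_t)\in\mathbb{N}^t$ uniquely characterize a simple game $v$ with minimum. If $v$ contains veto players but does not contain null players, then $\dim(v)=\max\{t-1,1\}$.
   Context: A simple game is a pair $(N,v)$ with $N$ a finite nonempty set of players and $v:2^N\to\{0,1\}$ satisfying $v(\emptyset)=0$, $v(N)=1$ and $v(S)\le v(T)$ whenever $S\subseteq T$. A coalition $S$ is winning if $v(S)=1$ and losing otherwise; it is minimal winning if it is winning and all its proper subsets are losing. $\mathbb N$ includes $0$. Players $a,b$ are equivalent (equi-desirable) if the transposition of $a$ and $b$ preserves the set of winning coalitions; let $N_1,\dots,N_t$ be the equivalence classes. To a coalition $S$ associate the vector $(|S\cap N_1|,\dots,|S\cap N_t|)$. The vectors of minimal winning coalitions are called minimal winning vectors. A simple game with minimum is a simple game with exactly one minimal winning vector. That $(\overline n,\overline m)$ uniquely characterizes the simple game $v$ with minimum means: $v$ has exactly the $t$ equivalence classes $N_1,\dots,N_t$ with $|N_i|=n_i$, and its unique minimal winning vector is $\overline m$; so $S$ is winning iff $|S\cap N_i|\ge m_i$ for all $i$. A player is null if it belongs to no minimal winning coalition (the players of $N_i$ are null iff $m_i=0$), and veto if it belongs to every winning coalition (the players of $N_i$ are veto iff $m_i=n_i$). A simple game $(N,v)$ is weighted if there are weights $w_i\in\mathbb R$ ($i\in N$) and a quota $q\in\mathbb R$ with $\sum_{i\in W}w_i\ge q>\sum_{i\in L}w_i$ for every winning coalition $W$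 and every losing coalition $L$. The intersection of simple games on the same player set $N$ is the game in which a coalition is winning iff it is winning in each of them. The dimension $\dim(v)$ is the smallest integer $k\ge1$ such that $v$ is the intersection of $k$ weighted games on $N$. *)

theory Defs
  imports Complex_Main "HOL-Combinatorics.Transposition"
begin

text \<open>
  A game is a player set \<open>N\<close> together with a function \<open>v\<close> on coalitions.  Only the values of
  \<open>v\<close> on subsets of \<open>N\<close> matter: every notion below quantifies over such subsets only.
\<close>

definition simple_game :: "'a set \<Rightarrow> ('a set \<Rightarrow> nat) \<Rightarrow> bool" where
  "simple_game N v \<longleftrightarrow>
     finite N \<and> N \<noteq> {} \<and> (\<forall>S\<subseteq>N. v S \<in> {0, 1}) \<and> v {} = 0 \<and> v N = 1 \<and>
     (\<forall>S T. S \<subseteq> T \<and> T \<subseteq> N \<longrightarrow> v S \<le> v T)"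

definition winning :: "'a set \<Rightarrow> ('a set \<Rightarrow> nat) \<Rightarrow> 'a set \<Rightarrow> bool" where
  "winning N v S \<longleftrightarrow> S \<subseteq> N \<and> v S = 1"

definition losing :: "'a set \<Rightarrow> ('a set \<Rightarrow> nat) \<Rightarrow> 'a set \<Rightarrow> bool" where
  "losing N v S \<longleftrightarrow> S \<subseteq> N \<and> v S \<noteq> 1"

definition minimal_winning :: "'a set \<Rightarrow> ('a set \<Rightarrow> nat) \<Rightarrow> 'a set \<Rightarrow> bool" where
  "minimal_winning N v S \<longleftrightarrow> winning N v S \<and> (\<forall>T. T \<subset> S \<longrightarrow> losing N v T)"

definition null_player :: "'a set \<Rightarrow> ('a set \<Rightarrow> nat) \<Rightarrow> 'a \<Rightarrow> bool" where
  "null_player N v a \<longleftrightarrow> a \<in> N \<and> \<not> (\<exists>S. minimal_winning N v S \<and> a \<in> S)"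

definition veto_player :: "'a set \<Rightarrow> ('a set \<Rightarrow> nat) \<Rightarrow> 'a \<Rightarrow> bool" where
  "veto_player N v a \<longleftrightarrow> a \<in> N \<and> (\<forall>S. winning N v S \<longrightarrow> a \<in> S)"

definition equi_desirable :: "'a set \<Rightarrow> ('a set \<Rightarrow> nat) \<Rightarrow> ('a \<times> 'a) set" where
  "equi_desirable N v =
     {(a, b). a \<in> N \<and> b \<in> N \<and>
        (\<forall>S\<subseteq>N. winning N v (transpose a b ` S) \<longleftrightarrow> winning N v S)}"

text \<open>
  The classes \<open>N\<^sub>1, \<dots>, N\<^sub>t\<close> are given as a list \<open>P\<close> without repetitions, and vectors of
  length \<open>t\<close> as lists of naturals indexed in the same order.
\<close>

definition lists_classes :: "'a set \<Rightarrow> ('a set \<Rightarrow> nat) \<Rightarrow> 'a set list \<Rightarrow> bool" where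
  "lists_classes N v P \<longleftrightarrow> distinct P \<and> set P = N // equi_desirable N v"

definition coalition_vector :: "'a set list \<Rightarrow> 'a set \<Rightarrow> nat list" where
  "coalition_vector P S = map (\<lambda>C. card (S \<inter> C)) P"

definition minimal_winning_vectors ::
    "'a set \<Rightarrow> ('a set \<Rightarrow> nat) \<Rightarrow> 'a set list \<Rightarrow> nat list set" where
  "minimal_winning_vectors N v P = coalition_vector P ` {S. minimal_winning N v S}"

text \<open>Reordering \<open>P\<close> permutes the vectors, so the choice of \<open>P\<close> is immaterial here.\<close>

definition simple_game_with_minimum :: "'a set \<Rightarrow> ('a set \<Rightarrow> nat) \<Rightarrow> bool" where
  "simple_game_with_minimum N v \<longleftrightarrow>
     simple_game N v \<and>
     (\<exists>P. lists_classes N v P \<and> (\<exists>!x. x \<in> minimal_winning_vectors N v P))"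

definition characterizes :: "nat list \<Rightarrow> nat list \<Rightarrow> 'a set \<Rightarrow> ('a set \<Rightarrow> nat) \<Rightarrow> bool" where
  "characterizes n m N v \<longleftrightarrow>
     (\<exists>P. lists_classes N v P \<and> map card P = n \<and> minimal_winning_vectors N v P = {m})"

definition weighted_game :: "'a set \<Rightarrow> ('a set \<Rightarrow> nat) \<Rightarrow> bool" where
  "weighted_game N v \<longleftrightarrow>
     simple_game N v \<and>
     (\<exists>(w :: 'a \<Rightarrow> real) (q :: real).
        (\<forall>W. winning N v W \<longrightarrow> q \<le> (\<Sum>i\<in>W. w i)) \<and>
        (\<forall>L. losing N v L \<longrightarrow> (\<Sum>i\<in>L. w i) < q))"

definition is_intersection ::
    "'a set \<Rightarrow> ('a set \<Rightarrow> nat) \<Rightarrow> nat \<Rightarrow> (nat \<Rightarrow> 'a set \<Rightarrow> nat) \<Rightarrow> bool" where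
  "is_intersection N v k u \<longleftrightarrow>
     (\<forall>S\<subseteq>N. winning N v S \<longleftrightarrow> (\<forall>i<k. winning N (u i) S))"

text \<open>
  Every simple game is an intersection of finitely many weighted games, so for simple games
  \<open>LEAST\<close> ranges over a nonempty set.
\<close>

definition game_dimension :: "'a set \<Rightarrow> ('a set \<Rightarrow> nat) \<Rightarrow> nat" where
  "game_dimension N v =
     (LEAST k. 1 \<le> k \<and> (\<exists>u. (\<forall>i<k. weighted_game N (u i)) \<and> is_intersection N v k u))"

end

theory Submission
  imports Defs
begin

text \<open>
  Write \<open>V\<close> for the set of veto players, and fix one minimal winning coalition \<open>T\<close>.  Exchanging
  equivalent players preserves winning, so whether a coalition wins depends only on how many
  players it takes from each class; as all minimal winning coalitions have the profile of \<open>T\<close>,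
  a coalition \<open>S\<close> wins iff \<open>card (T \<inter> C) \<le> card (S \<inter> C)\<close> for every class \<open>C\<close>
  (lemma \<open>winning_iff_profile\<close>).  The veto players form exactly one class, and every other
  class \<open>C\<close> satisfies \<open>0 < card (T \<inter> C) < card C\<close>: the lower bound because there are no null
  players, the upper one because otherwise the players of \<open>C\<close> would be veto.

  \<^emph>\<open>Upper bound.\<close>  The veto requirement can be merged with the requirement of one other class
  \<open>C\<close> in a single weighted game: veto players get a weight so large that the absence of one
  cannot be compensated by all of \<open>C\<close> (lemma \<open>weighted_veto_threshold\<close>).  Intersecting these
  games over the \<open>t - 1\<close> non-veto classes gives \<open>v\<close>; if there is no such class, \<open>v\<close> is the game
  in which exactly the coalitions containing \<open>V\<close> win, which is weighted.

  \<^emph>\<open>Lower bound.\<close>  For each non-veto class \<open>C\<close> let \<open>L C\<close> be the grand coalition with just so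
  many players of \<open>C\<close> removed that it falls short of the requirement of \<open>C\<close> by one.  It loses.
  For two different classes \<open>C\<close> and \<open>D\<close>, let \<open>L C\<close> give a player of \<open>D\<close> to \<open>L D\<close> in return for a
  player of \<open>C\<close>: both coalitions then win, since \<open>card (T \<inter> C) < card C\<close> and likewise for \<open>D\<close>,
  although their total weight is unchanged.  Hence no weighted component can reject both \<open>L C\<close>
  and \<open>L D\<close>, and there are at least as many components as non-veto classes
  (lemma \<open>components_ge_trading_family\<close>).
\<close>

section \<open>Equivalence classes and profiles\<close>

lemma equiv_equi_desirable: "equiv N (equi_desirable N v)"
proof (rule equivI)
  show "equi_desirable N v \<subseteq> N \<times> N"
    by (auto simp: equi_desirable_def)
  show "refl_on N (equi_desirable N v)"
    by (auto simp: refl_on_def equi_desirable_def)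
  show "sym (equi_desirable N v)"
    by (auto simp: sym_def equi_desirable_def transpose_commute)
  show "trans (equi_desirable N v)"
  proof (rule transI)
    fix a b c
    assume ab: "(a, b) \<in> equi_desirable N v" and bc: "(b, c) \<in> equi_desirable N v"
    have sub: "transpose x y ` S \<subseteq> N" if "x \<in> N" "y \<in> N" "S \<subseteq> N" for x y S
      using that by (auto simp: transpose_def)
    have abc: "a \<in> N" "b \<in> N" "c \<in> N"
      using ab bc by (auto simp: equi_desirable_def)
    have iab: "winning N v (transpose a b ` S) \<longleftrightarrow> winning N v S" if "S \<subseteq> N" for S
      using ab that by (auto simp: equi_desirable_def)
    have ibc: "winning N v (transpose b c ` S) \<longleftrightarrow> winning N v S" if "S \<subseteq> N" for S
      using bc that by (auto simp: equi_desirable_def)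
    have "winning N v (transpose a c ` S) \<longleftrightarrow> winning N v S" if S: "S \<subseteq> N" for S
    proof (cases "b = c \<or> a = c")
      case True
      then show ?thesis
        using iab[OF S] by auto
    next
      case False
      \<comment> \<open>The transposition of \<open>a\<close> and \<open>c\<close> is that of \<open>b\<close> and \<open>c\<close> conjugated by that of \<open>a\<close>
        and \<open>b\<close>.\<close>
      then have "transpose a c = transpose a b \<circ> transpose b c \<circ> transpose a b"
        by (auto simp: fun_eq_iff transpose_def)
      then have "transpose a c ` S = transpose a b ` transpose b c ` transpose a b ` S"
        by (simp add: image_comp)
      then show ?thesis
        using iab ibc sub abc S by simp
    qed
    then show "(a, c) \<in> equi_desirable N v"
      using abc by (auto simp: equi_desirable_def)
  qed
qed

lemma winning_mono:
  assumes "simple_game N v" "winning N v S" "S \<subseteq> T" "T \<subseteq> N"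
  shows "winning N v T"
proof -
  have "v S \<le> v T" "v T \<in> {0, 1}" "v S = 1"
    using assms unfolding simple_game_def winning_def by blast+
  then show ?thesis
    using assms(4) by (auto simp: winning_def)
qed

lemma obtain_minimal_winning:
  assumes "simple_game N v" "winning N v S"
  obtains T where "minimal_winning N v T" "T \<subseteq> S"
proof -
  let ?F = "{T. T \<subseteq> S \<and> winning N v T}"
  have "finite N"
    using assms(1) by (simp add: simple_game_def)
  moreover have "?F \<subseteq> Pow N"
    by (auto simp: winning_def)
  ultimately have "finite ?F"
    using finite_subset by blast
  moreover have "?F \<noteq> {}"
    using assms(2) by blast
  ultimately obtain T where T: "T \<in> ?F" "\<forall>U\<in>?F. U \<subseteq> T \<longrightarrow> T = U"
    by (elim bexE[OF finite_has_minimal])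
  have "losing N v U" if "U \<subset> T" for U
  proof -
    have "\<not> winning N v U"
      using T that by blast
    moreover have "U \<subseteq> N"
      using T(1) that by (auto simp: winning_def)
    ultimately show ?thesis
      by (simp add: losing_def winning_def)
  qed
  then have "minimal_winning N v T"
    using T(1) by (simp add: minimal_winning_def)
  with T show ?thesis
    using that by blast
qed

text \<open>
  Players of \<open>A - B\<close> are replaced one at a time by equivalent players of \<open>B - A\<close>, which leaves
  the profile of \<open>A\<close> unchanged; when no such player is left, \<open>A\<close> is contained in \<open>B\<close>.
\<close>

lemma winning_if_profile_ge:
  assumes "simple_game N v" "winning N v A" "B \<subseteq> N"
    and "\<And>C. C \<in> N // equi_desirable N v \<Longrightarrow> card (A \<inter> C) \<le> card (B \<inter> C)"
  shows "winning N v B"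
  using assms(2,4)
proof (induction "card (A - B)" arbitrary: A rule: less_induct)
  case less
  let ?E = "equi_desirable N v"
  have fin: "finite N" and A: "A \<subseteq> N"
    using assms(1) less.prems(1) by (simp_all add: simple_game_def winning_def)
  have finA: "finite A"
    using fin A finite_subset by blast
  show ?case
  proof (cases "A \<subseteq> B")
    case True
    then show ?thesis
      using winning_mono assms(1,3) less.prems(1) by blast
  next
    case False
    then obtain a where a: "a \<in> A" "a \<notin> B" "a \<in> N"
      using A by auto
    have aE: "a \<in> ?E `` {a}"
      using equiv_equi_desirable a(3) by (rule equiv_class_self)
    have le: "card (A \<inter> ?E `` {a}) \<le> card (B \<inter> ?E `` {a})"
      using a(3) by (intro less.prems quotientI)
    have "\<not> B \<inter> ?E `` {a} \<subseteq> A \<inter> ?E `` {a}"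
    proof
      assume "B \<inter> ?E `` {a} \<subseteq> A \<inter> ?E `` {a}"
      then have "B \<inter> ?E `` {a} \<subset> A \<inter> ?E `` {a}"
        using a aE by auto
      then have "card (B \<inter> ?E `` {a}) < card (A \<inter> ?E `` {a})"
        using finA by (intro psubset_card_mono) auto
      with le show False
        by simp
    qed
    then obtain b where b: "b \<in> B" "b \<notin> A" "(a, b) \<in> ?E"
      by auto
    define A' where "A' = transpose a b ` A"
    have A': "A' = insert b (A - {a})"
      using a b by (auto simp: A'_def transpose_def image_iff)
    have "winning N v A'"
      using b(3) less.prems(1) A by (auto simp: A'_def equi_desirable_def)
    moreover have "card (A' - B) < card (A - B)"
    proof (rule psubset_card_mono)
      show "A' - B \<subset> A - B"
        using a b by (auto simp: A')
    qed (use finA in simp)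
    moreover have "card (A' \<inter> C) \<le> card (B \<inter> C)" if C: "C \<in> N // ?E" for C
    proof -
      have "a \<in> C \<longleftrightarrow> b \<in> C"
        using in_quotient_imp_closed[OF equiv_equi_desirable C] b(3)
          equiv_equi_desirable[of N v, THEN equivE] by (blast dest: symD)
      then have "transpose a b ` C = C"
        by simp
      then have "A' \<inter> C = transpose a b ` (A \<inter> C)"
        using image_Int[OF inj_transpose, of a b A C] by (simp add: A'_def)
      then have "card (A' \<inter> C) = card (A \<inter> C)"
        by (simp add: card_image)
      then show ?thesis
        using less.prems(2)[OF C] by simp
    qed
    ultimately show ?thesis
      using less.hyps by blast
  qed
qed

text \<open>
  A winning coalition contains a minimal winning one, whose profile is that of \<open>T\<close>; conversely,
  a profile at least that of \<open>T\<close> suffices by the previous lemma.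
\<close>

lemma winning_iff_profile:
  assumes "simple_game N v" "minimal_winning N v T"
    and "\<And>S C. minimal_winning N v S \<Longrightarrow> C \<in> N // equi_desirable N v \<Longrightarrow>
          card (S \<inter> C) = card (T \<inter> C)"
  shows "winning N v S \<longleftrightarrow>
    S \<subseteq> N \<and> (\<forall>C \<in> N // equi_desirable N v. card (T \<inter> C) \<le> card (S \<inter> C))"
proof
  assume S: "winning N v S"
  obtain U where U: "minimal_winning N v U" "U \<subseteq> S"
    by (rule obtain_minimal_winning[OF assms(1) S])
  have "S \<subseteq> N" "finite N"
    using S assms(1) by (simp_all add: winning_def simple_game_def)
  then have "finite S"
    using finite_subset by blast
  have "card (T \<inter> C) \<le> card (S \<inter> C)" if "C \<in> N // equi_desirable N v" for C
    unfolding assms(3)[OF U(1) that, symmetric]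
    using U(2) \<open>finite S\<close> by (intro card_mono) auto
  then show "S \<subseteq> N \<and> (\<forall>C \<in> N // equi_desirable N v. card (T \<inter> C) \<le> card (S \<inter> C))"
    using \<open>S \<subseteq> N\<close> by blast
next
  assume "S \<subseteq> N \<and> (\<forall>C \<in> N // equi_desirable N v. card (T \<inter> C) \<le> card (S \<inter> C))"
  moreover have "winning N v T"
    using assms(2) unfolding minimal_winning_def by blast
  ultimately show "winning N v S"
    by (intro winning_if_profile_ge[OF assms(1), of T S]) blast+
qed

text \<open>
  Two veto players belong to the same winning coalitions, so they are equivalent.  Conversely, a
  winning coalition that omits a player equivalent to a veto player is mapped by their
  transposition to a winning coalition that omits the veto player.
\<close>

lemma veto_players_form_class:
  assumes "veto_player N v a"
  shows "{x. veto_player N v x} = equi_desirable N v `` {a}"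
proof (intro equalityI subsetI)
  fix b assume "b \<in> {x. veto_player N v x}"
  then have b: "veto_player N v b"
    by simp
  have both: "a \<in> X \<and> b \<in> X" if "winning N v X" for X
    using that assms b by (simp add: veto_player_def)
  have "transpose a b ` S = S" if "winning N v S \<or> winning N v (transpose a b ` S)" for S
  proof (rule transpose_image_eq)
    show "a \<in> S \<longleftrightarrow> b \<in> S"
      using that
    proof
      assume "winning N v (transpose a b ` S)"
      then have "transpose a b a \<in> S \<and> transpose a b b \<in> S"
        using both[of "transpose a b ` S"] by (simp only: in_transpose_image_iff)
      then show ?thesis
        by simp
    qed (use both[of S] in simp)
  qed
  then have "winning N v (transpose a b ` S) \<longleftrightarrow> winning N v S" for S
    by fastforce
  then show "b \<in> equi_desirable N v `` {a}"
    using assms b by (auto simp: equi_desirable_def veto_player_def)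
next
  fix b assume "b \<in> equi_desirable N v `` {a}"
  then have b: "b \<in> N" "\<And>S. S \<subseteq> N \<Longrightarrow> winning N v (transpose a b ` S) \<longleftrightarrow> winning N v S"
    by (auto simp: equi_desirable_def)
  have "b \<in> S" if S: "winning N v S" for S
  proof -
    have "winning N v (transpose a b ` S)"
      using S b(2) by (simp add: winning_def)
    then have "a \<in> transpose a b ` S"
      using assms unfolding veto_player_def by simp
    then show ?thesis
      by (simp add: in_transpose_image_iff)
  qed
  then show "b \<in> {x. veto_player N v x}"
    using b by (simp add: veto_player_def)
qed

section \<open>Weighted components\<close>

definition veto_threshold_game :: "'a set \<Rightarrow> 'a set \<Rightarrow> nat \<Rightarrow> 'a set \<Rightarrow> nat" where
  "veto_threshold_game V C c S = (if V \<subseteq> S \<and> c \<le> card (S \<inter> C) then 1 else 0)"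

text \<open>
  A veto player weighs \<open>card C + 1\<close>, a player of \<open>C\<close> weighs 1 and any other player 0, so the loss
  of one veto player outweighs the whole of \<open>C\<close>.
\<close>

lemma weighted_veto_threshold:
  assumes "finite N" "V \<subseteq> N" "V \<noteq> {}" "C \<subseteq> N" "V \<inter> C = {}" "c \<le> card C"
  shows "weighted_game N (veto_threshold_game V C c)"
  unfolding weighted_game_def
proof
  have "veto_threshold_game V C c S \<le> veto_threshold_game V C c T"
    if "S \<subseteq> T" "T \<subseteq> N" for S T
  proof -
    have "card (S \<inter> C) \<le> card (T \<inter> C)"
      using that assms finite_subset[of T N] by (intro card_mono) auto
    then show ?thesis
      using that by (auto simp: veto_threshold_game_def)
  qed
  moreover have "veto_threshold_game V C c N = 1"
    using assms by (simp add: veto_threshold_game_def Int_absorb1)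
  ultimately show "simple_game N (veto_threshold_game V C c)"
    using assms(1-3) unfolding simple_game_def
    by (auto simp: veto_threshold_game_def)
next
  let ?u = "veto_threshold_game V C c"
  define K where "K = real (card C) + 1"
  define w where "w x = (if x \<in> V then K else 0) + (if x \<in> C then 1 else 0)" for x :: 'a
  define q where "q = K * card V + c"
  have fin: "finite V" "finite C"
    using assms(2,4) finite_subset[OF _ assms(1)] by blast+
  have weight: "sum w S = K * card (S \<inter> V) + card (S \<inter> C)" if "S \<subseteq> N" for S
  proof -
    have "finite S"
      using that assms(1) finite_subset by blast
    then show ?thesis
      by (simp add: w_def sum.distrib sum.If_cases mult.commute)
  qed
  have "q \<le> sum w W" if "winning N ?u W" for W
  proof -
    have W: "W \<subseteq> N" "V \<subseteq> W" "c \<le> card (W \<inter> C)"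
      using that by (auto simp: winning_def veto_threshold_game_def split: if_splits)
    then show ?thesis
      using weight[OF W(1)] by (simp add: q_def Int_absorb1)
  qed
  moreover have "sum w L < q" if "losing N ?u L" for L
  proof -
    have L: "L \<subseteq> N" "V \<subseteq> L \<Longrightarrow> card (L \<inter> C) < c"
      using that by (auto simp: losing_def veto_threshold_game_def split: if_splits)
    show ?thesis
    proof (cases "V \<subseteq> L")
      case True
      then show ?thesis
        using weight[OF L(1)] L(2) by (simp add: q_def Int_absorb1)
    next
      case False
      then have "card (L \<inter> V) < card V"
        using fin by (intro psubset_card_mono) auto
      then have "real (card (L \<inter> V)) + 1 \<le> card V"
        by linarith
      then have "K * (real (card (L \<inter> V)) + 1) \<le> K * card V"
        by (intro mult_left_mono) (auto simp: K_def)
      moreover have "card (L \<inter> C) \<le> card C"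
        using fin by (intro card_mono) auto
      then have "real (card (L \<inter> C)) < K"
        by (simp add: K_def)
      ultimately show ?thesis
        using weight[OF L(1)] by (simp add: q_def algebra_simps)
    qed
  qed
  ultimately show "\<exists>(w :: 'a \<Rightarrow> real) q. (\<forall>W. winning N ?u W \<longrightarrow> q \<le> sum w W) \<and>
      (\<forall>L. losing N ?u L \<longrightarrow> sum w L < q)"
    by blast
qed

text \<open>
  A component that rejects two members of the family gives them together less than twice its
  quota.  The trade yields two coalitions of the same total weight that win in \<open>v\<close>, hence in
  every component, and so have together at least twice the quota.  Thus each component rejects at
  most one member, while every member is rejected by some component.
\<close>

lemma components_ge_trading_family:
  assumes "\<And>j. j < k \<Longrightarrow> weighted_game N (u j)" and "is_intersection N v k u"
    and losing: "\<And>i. i \<in> I \<Longrightarrow> losing N v (L i)"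
    and trade: "\<And>i i'. i \<in> I \<Longrightarrow> i' \<in> I \<Longrightarrow> i \<noteq> i' \<Longrightarrow>
      \<exists>W W'. winning N v W \<and> winning N v W' \<and>
        (\<forall>w :: 'a \<Rightarrow> real. sum w W + sum w W' = sum w (L i) + sum w (L i'))"
  shows "card I \<le> k"
proof -
  have "\<exists>j<k. losing N (u j) (L i)" if "i \<in> I" for i
    using losing[OF that] assms(2)
    by (auto simp: is_intersection_def losing_def winning_def)
  then obtain f where f: "\<And>i. i \<in> I \<Longrightarrow> f i < k \<and> losing N (u (f i)) (L i)"
    by metis
  have "inj_on f I"
  proof (rule inj_onI, rule ccontr)
    fix i i' assume i: "i \<in> I" "i' \<in> I" "f i = f i'" "i \<noteq> i'"
    obtain W W' where W: "winning N v W" "winning N v W'"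
      and eq: "\<And>w :: 'a \<Rightarrow> real. sum w W + sum w W' = sum w (L i) + sum w (L i')"
      using trade[OF i(1,2,4)] by blast
    obtain w :: "'a \<Rightarrow> real" and q where
      ge: "\<And>S. winning N (u (f i)) S \<Longrightarrow> q \<le> sum w S" and
      lt: "\<And>S. losing N (u (f i)) S \<Longrightarrow> sum w S < q"
      using assms(1)[of "f i"] f[OF i(1)] by (auto simp: weighted_game_def)
    have "winning N (u (f i)) W" "winning N (u (f i)) W'"
      using W assms(2) f[OF i(1)] by (auto simp: is_intersection_def winning_def)
    moreover have "losing N (u (f i)) (L i)" "losing N (u (f i)) (L i')"
      using f i by metis+
    ultimately show False
      using ge lt eq[of w] by (smt (verit))
  qed
  moreover have "f ` I \<subseteq> {..<k}"
    using f by auto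
  ultimately show ?thesis
    using card_inj_on_le[of f I "{..<k}"] by simp
qed

section \<open>Dimension in terms of the classes\<close>

text \<open>
  Below, \<open>V\<close> and \<open>Q\<close> stand for the veto class and the set of the other classes, and \<open>T\<close> for a
  minimal winning coalition, which records how many players each class has to contribute.

  The bound comes from the losing coalitions \<open>L C\<close>, which miss the requirement of one class \<open>C\<close> by
  a single player and contain everybody outside \<open>C\<close>.
\<close>

lemma components_ge_nonveto_classes:
  assumes win: "\<And>S. winning N v S \<longleftrightarrow>
      S \<subseteq> N \<and> V \<subseteq> S \<and> (\<forall>C\<in>Q. card (T \<inter> C) \<le> card (S \<inter> C))"
    and fin: "finite N" and "V \<subseteq> N"
    and Q: "\<And>C. C \<in> Q \<Longrightarrow> C \<subseteq> N \<and> V \<inter> C = {} \<and> 0 < card (T \<inter> C) \<and> card (T \<inter> C) < card C"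
    and disj: "\<And>C D. C \<in> Q \<Longrightarrow> D \<in> Q \<Longrightarrow> C \<noteq> D \<Longrightarrow> C \<inter> D = {}"
    and "\<And>j. j < k \<Longrightarrow> weighted_game N (u j)" and "is_intersection N v k u"
  shows "card Q \<le> k"
proof -
  have "\<exists>R\<subseteq>C. card R = card (T \<inter> C) - 1 \<and> finite R" if "C \<in> Q" for C
    using Q[OF that] obtain_subset_with_card_n[of "card (T \<inter> C) - 1" C]
    by (metis diff_le_self less_imp_le_nat order_trans)
  then obtain R where R: "\<And>C. C \<in> Q \<Longrightarrow> R C \<subseteq> C \<and> card (R C) = card (T \<inter> C) - 1 \<and> finite (R C)"
    by metis
  define L where "L C = (N - C) \<union> R C" for C
  have LC: "L C \<inter> C = R C" if "C \<in> Q" for C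
    using R[OF that] by (auto simp: L_def)
  have LN: "L C \<subseteq> N" if "C \<in> Q" for C
    using R[OF that] Q[OF that] by (auto simp: L_def)
  \<comment> \<open>Half of a trade: \<open>L C\<close> gains a missing player of \<open>C\<close> and gives up one player of \<open>D\<close>,
    which it can afford because \<open>D\<close> is not required in full.\<close>
  have exch: "winning N v (insert x (L C - {y}))"
    if "C \<in> Q" "D \<in> Q" "C \<noteq> D" "x \<in> C - L C" "y \<in> D" for C D x y
  proof -
    let ?S = "insert x (L C - {y})"
    have CD: "C \<inter> D = {}"
      using disj that by blast
    have S: "?S \<subseteq> N" "V \<subseteq> ?S"
      using LN[OF that(1)] Q[OF that(1)] Q[OF that(2)] that \<open>V \<subseteq> N\<close> by (auto simp: L_def)
    have "card (T \<inter> B) \<le> card (?S \<inter> B)" if "B \<in> Q" for B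
    proof (cases "B = C \<or> B = D")
      case False
      then have "?S \<inter> B = B"
        using disj[of B C] disj[of B D] \<open>B \<in> Q\<close> Q[of B] \<open>C \<in> Q\<close> \<open>D \<in> Q\<close> \<open>y \<in> D\<close>
        by (auto simp: L_def)
      then show ?thesis
        using Q[of B] \<open>B \<in> Q\<close> by simp
    next
      case True
      then consider "B = C" | "B = D" by blast
      then show ?thesis
      proof cases
        case 1
        then have "?S \<inter> B = insert x (R C)"
          using LC[OF \<open>C \<in> Q\<close>] CD \<open>x \<in> C - L C\<close> \<open>y \<in> D\<close> by auto
        moreover have "x \<notin> R C"
          using \<open>x \<in> C - L C\<close> by (auto simp: L_def)
        ultimately have "card (?S \<inter> B) = card (T \<inter> C) - 1 + 1"
          using R[OF \<open>C \<in> Q\<close>] by simp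
        then show ?thesis
          unfolding 1 by linarith
      next
        case 2
        then have "?S \<inter> B = D - {y}"
          using CD Q[OF \<open>D \<in> Q\<close>] R[OF \<open>C \<in> Q\<close>] \<open>x \<in> C - L C\<close> by (auto simp: L_def)
        then have "card (?S \<inter> B) = card D - 1"
          using \<open>y \<in> D\<close> by simp
        then show ?thesis
          using Q[OF \<open>D \<in> Q\<close>] unfolding 2 by linarith
      qed
    qed
    with S show ?thesis
      by (simp add: win)
  qed
  show ?thesis
  proof (rule components_ge_trading_family[where L = L])
    fix C assume C: "C \<in> Q"
    have "\<not> card (T \<inter> C) \<le> card (L C \<inter> C)"
      unfolding LC[OF C] using R[OF C] Q[OF C] by linarith
    then have "\<not> winning N v (L C)"
      using C win by blast
    then show "losing N v (L C)"
      using LN[OF C] by (auto simp: losing_def winning_def)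
  next
    fix C D assume CD: "C \<in> Q" "D \<in> Q" "C \<noteq> D"
    have short: "\<exists>x. x \<in> B - L B" if "B \<in> Q" for B
    proof (rule ccontr)
      assume "\<not> (\<exists>x. x \<in> B - L B)"
      then have "R B = B"
        using LC[OF that] by auto
      then show False
        using R[OF that] Q[OF that] by auto
    qed
    obtain x y where x: "x \<in> C - L C" and y: "y \<in> D - L D"
      using short CD by meson
    have in_other: "x \<in> L D" "y \<in> L C"
      using x y CD disj[OF CD] Q[of C] Q[of D] by (auto simp: L_def)
    have finL: "finite (L C)" "finite (L D)"
      using LN CD fin finite_subset by blast+
    have "sum w (insert x (L C - {y})) + sum w (insert y (L D - {x}))
        = sum w (L C) + sum w (L D)" for w :: "'a \<Rightarrow> real"
      using x y in_other finL by (simp add: sum_diff1)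
    moreover have "winning N v (insert x (L C - {y}))"
      using exch[of C D x y] CD x y by blast
    moreover have "winning N v (insert y (L D - {x}))"
      using exch[of D C y x] CD x y by blast
    ultimately show "\<exists>W W'. winning N v W \<and> winning N v W' \<and>
        (\<forall>w :: 'a \<Rightarrow> real. sum w W + sum w W' = sum w (L C) + sum w (L D))"
      by blast
  qed (fact assms)+
qed

text \<open>
  If \<open>Q\<close> is nonempty, then one component per class in \<open>Q\<close>, each also enforcing the veto,
  represents \<open>v\<close>, and by the previous lemma fewer components cannot.  If \<open>Q\<close> is empty, the veto
  still needs one component.
\<close>

lemma dimension_by_nonveto_classes:
  assumes win: "\<And>S. winning N v S \<longleftrightarrow>
      S \<subseteq> N \<and> V \<subseteq> S \<and> (\<forall>C\<in>Q. card (T \<inter> C) \<le> card (S \<inter> C))"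
    and fin: "finite N" and V: "V \<subseteq> N" "V \<noteq> {}"
    and Q: "\<And>C. C \<in> Q \<Longrightarrow> C \<subseteq> N \<and> V \<inter> C = {} \<and> 0 < card (T \<inter> C) \<and> card (T \<inter> C) < card C"
    and disj: "\<And>C D. C \<in> Q \<Longrightarrow> D \<in> Q \<Longrightarrow> C \<noteq> D \<Longrightarrow> C \<inter> D = {}"
  shows "game_dimension N v = max (card Q) 1"
  unfolding game_dimension_def
proof (rule Least_equality)
  show "1 \<le> max (card Q) 1 \<and> (\<exists>u. (\<forall>i<max (card Q) 1. weighted_game N (u i)) \<and>
      is_intersection N v (max (card Q) 1) u)"
  proof (cases "Q = {}")
    case True
    \<comment> \<open>With an empty threshold class, only the veto requirement remains.\<close>
    let ?u = "\<lambda>i :: nat. veto_threshold_game V {} 0"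
    have "weighted_game N (?u i)" for i
      using weighted_veto_threshold[of N V "{}" 0] fin V by simp
    moreover have "is_intersection N v (max (card Q) 1) ?u"
      using True win by (auto simp: is_intersection_def winning_def veto_threshold_game_def)
    ultimately show ?thesis
      by (intro conjI exI[of _ ?u]) auto
  next
    case False
    have finQ: "finite Q"
      using Q fin by (intro finite_subset[of Q "Pow N"]) auto
    then have max: "max (card Q) 1 = card Q"
      using False by (metis card_0_eq less_one max.absorb1 not_le)
    obtain h where h: "bij_betw h {0..<card Q} Q"
      using ex_bij_betw_nat_finite[OF finQ] by blast
    then have hQ: "Q = h ` {..<card Q}"
      by (auto simp: bij_betw_def lessThan_atLeast0)
    let ?u = "\<lambda>i. veto_threshold_game V (h i) (card (T \<inter> h i))"
    have "weighted_game N (?u i)" if "i < card Q" for i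
    proof -
      have "h i \<in> Q"
        using that hQ by blast
      then show ?thesis
        using Q[of "h i"] fin V by (intro weighted_veto_threshold) auto
    qed
    moreover have "is_intersection N v (card Q) ?u"
      unfolding is_intersection_def
    proof (intro allI impI)
      fix S assume S: "S \<subseteq> N"
      have "(\<forall>C\<in>Q. card (T \<inter> C) \<le> card (S \<inter> C)) \<longleftrightarrow>
          (\<forall>i<card Q. card (T \<inter> h i) \<le> card (S \<inter> h i))"
        by (subst hQ) auto
      moreover have "0 < card Q"
        using False finQ by (simp add: card_gt_0_iff)
      ultimately show "winning N v S \<longleftrightarrow> (\<forall>i<card Q. winning N (?u i) S)"
        unfolding win using S
        by (auto simp: winning_def veto_threshold_game_def split: if_splits)
    qed
    ultimately show ?thesis
      unfolding max using False finQ
      by (intro conjI exI[of _ ?u]) (auto simp: Suc_le_eq card_gt_0_iff)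
  qed
next
  fix k
  assume "1 \<le> k \<and> (\<exists>u. (\<forall>i<k. weighted_game N (u i)) \<and> is_intersection N v k u)"
  then show "max (card Q) 1 \<le> k"
    using components_ge_nonveto_classes[OF win fin V(1) Q disj] by auto
qed

theorem theorem4p3:
  fixes N :: "'a set" and v :: "'a set \<Rightarrow> nat" and n m :: "nat list" and t :: nat
  assumes "length n = t" and "length m = t" and "\<forall>x\<in>set n. 0 < x"
    and "simple_game_with_minimum N v"
    and "characterizes n m N v"
    and "\<exists>a. veto_player N v a"
    and "\<not> (\<exists>a. null_player N v a)"
  shows "game_dimension N v = max (t - 1) 1"
proof -
  let ?E = "equi_desirable N v"
  have game: "simple_game N v"
    using assms(4) by (simp add: simple_game_with_minimum_def)
  then have fin: "finite N"
    by (simp add: simple_game_def)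
  obtain P where P: "distinct P" "set P = N // ?E" "map card P = n"
    and vec: "minimal_winning_vectors N v P = {m}"
    using assms(5) by (auto simp: characterizes_def lists_classes_def)
  obtain T where T: "minimal_winning N v T"
    using vec by (auto simp: minimal_winning_vectors_def)
  have same: "card (S \<inter> C) = card (T \<inter> C)" if "minimal_winning N v S" "C \<in> N // ?E" for S C
  proof -
    have "coalition_vector P U = m" if "minimal_winning N v U" for U
    proof -
      have "coalition_vector P U \<in> minimal_winning_vectors N v P"
        using that by (simp add: minimal_winning_vectors_def)
      then show ?thesis
        by (simp add: vec)
    qed
    from this[OF that(1)] this[OF T] have "coalition_vector P S = coalition_vector P T"
      by simp
    then show ?thesis
      using that(2) P(2) by (simp add: coalition_vector_def)
  qed
  note profile = winning_iff_profile[OF game T same]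
  obtain a where a: "veto_player N v a"
    using assms(6) by blast
  define V where "V = {x. veto_player N v x}"
  have V_class: "V \<in> N // ?E"
    using a veto_players_form_class[OF a] by (auto simp: V_def veto_player_def intro: quotientI)
  have VN: "V \<subseteq> N" "V \<noteq> {}"
    using a by (auto simp: V_def veto_player_def)
  have VS: "V \<subseteq> S" if "winning N v S" for S
    using that by (auto simp: V_def veto_player_def)
  have class_sub: "C \<subseteq> N" if "C \<in> N // ?E" for C
    using that equiv_equi_desirable[of N v] by (metis Union_quotient Union_upper)
  have finC: "finite C" if "C \<in> N // ?E" for C
    using class_sub[OF that] fin finite_subset by blast
  have disj: "C \<inter> D = {}" if "C \<in> N // ?E" "D \<in> N // ?E" "C \<noteq> D" for C D
    using quotient_disj[OF equiv_equi_desirable that(1,2)] that(3) by blast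
  define Q where "Q = N // ?E - {V}"
  have "game_dimension N v = max (card Q) 1"
  proof (rule dimension_by_nonveto_classes[OF _ fin VN])
    fix S
    have "card (T \<inter> V) \<le> card (S \<inter> V)" if "V \<subseteq> S"
      using that finC[OF V_class] by (intro card_mono) auto
    then show "winning N v S \<longleftrightarrow>
        S \<subseteq> N \<and> V \<subseteq> S \<and> (\<forall>C\<in>Q. card (T \<inter> C) \<le> card (S \<inter> C))"
      using profile[of S] VS[of S] by (auto simp: Q_def)
  next
    fix C assume "C \<in> Q"
    then have C: "C \<in> N // ?E" "C \<noteq> V"
      by (auto simp: Q_def)
    obtain x where x: "x \<in> C"
      using in_quotient_imp_non_empty[OF equiv_equi_desirable C(1)] by blast
    have "0 < card (T \<inter> C)"
    proof -
      obtain S where S: "minimal_winning N v S" "x \<in> S"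
        using assms(7) x class_sub[OF C(1)] by (auto simp: null_player_def)
      have "0 < card (S \<inter> C)"
        using x S(2) finC[OF C(1)] by (auto simp: card_gt_0_iff)
      then show ?thesis
        using same[OF S(1) C(1)] by simp
    qed
    moreover have "card (T \<inter> C) < card C"
    proof (rule ccontr)
      assume "\<not> card (T \<inter> C) < card C"
      then have "C \<subseteq> S" if "winning N v S" for S
        using that profile[of S] C(1) card_subset_eq[OF finC[OF C(1)], of "S \<inter> C"]
          card_mono[OF finC[OF C(1)], of "S \<inter> C"]
        by (metis Int_lower2 inf.absorb_iff2 le_antisym not_less order_trans)
      then have "x \<in> V"
        using x class_sub[OF C(1)] by (auto simp: V_def veto_player_def)
      then show False
        using disj[OF C(1) V_class C(2)] x by blast
    qed
    ultimately show "C \<subseteq> N \<and> V \<inter> C = {} \<and> 0 < card (T \<inter> C) \<and> card (T \<inter> C) < card C"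
      using class_sub[OF C(1)] disj[OF C(1) V_class C(2)] by auto
  qed (use disj in \<open>auto simp: Q_def\<close>)
  moreover have "card Q = t - 1"
  proof -
    have "card (N // ?E) = t"
      using P assms(1) distinct_card by fastforce
    then show ?thesis
      using V_class by (simp add: Q_def)
  qed
  ultimately show ?thesis
    by simp
qed

end
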